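(* Let $R$ be a commutative unital $2$-torsion-free ring (that is, $2x=0$ implies $x=0$ for $x\in R$), let $V$ be a finite set, and let $w_{ij}=w_{ji}\in R$ ($i,j\in V$) be symmetric weights with $w_{ii}=0$. On $\mathfrak g=R^V$ consider the bracket $[f,g]_i=\sum_j w_{ij}(f_ig_j-f_jg_i)$ and the canonical cobracket $\delta:\mathfrak g\to\bigwedge^2\mathfrak g$, $\delta(e_i)=\sum_j w_{ij}\,e_i\wedge e_j$. Then $(\mathfrak g,[\,,\,],\delta)$ is a Lie bialgebra over $R$ if and only if $$w_{ij}w_{ik}=0\qquad\text{for all } i,j,k\in V \text{ with } j\neq k .$$
   Context: $\{e_i\}_{i\in V}$ is the coordinate basis of $R^V$; $\delta$ is extended $R$-linearly. "Lie bialgebra over $R$" is in the finite free module sense: the bracket is $R$-bilinear, antisymmetric and satisfies the Jacobi identity; the $R$-linear map $\delta$ satisfies co-Jacobi, i.e. the induced bracket on $\mathfrak g^*$, $\langle[\xi,\eta]^*,x\rangle=\langle\xi\wedge\eta,\delta(x)\rangle$ with $\langle\xi\wedge\eta,u\wedge v\rangle=\xi(u)\eta(v)-\xi(v)\eta(u)$, satisfies the Jacobi identity; and $\delta$ satisfies the $1$-cocycle condition $\delta([x,y])=\operatorname{ad}^{(2)}_x\delta(y)-\operatorname{ad}^{(2)}_y\delta(x)$ for all $x,y\in\mathfrak g$, where $\operatorname{ad}^{(2)}_x(u\wedge v)=[x,u]\wedge v+u\wedge[x,v]$. *)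

theory Defs
  imports Complex_Main "HOL-Library.Function_Algebras"
begin

text \<open>
  The free module \<open>R\<^sup>V\<close> on a finite set \<open>V\<close> is the set of functions vanishing off \<open>V\<close>, so that
  equality of vectors is equality of functions. Sums of functions are pointwise.
\<close>

definition free_mod :: "'v set \<Rightarrow> ('v \<Rightarrow> 'a::comm_ring_1) set" where
  "free_mod V = {f. \<forall>i. i \<notin> V \<longrightarrow> f i = 0}"

definition basis_vec :: "'v \<Rightarrow> 'v \<Rightarrow> 'a::comm_ring_1" where
  "basis_vec i = (\<lambda>k. if k = i then 1 else 0)"

definition scale1 :: "'a::comm_ring_1 \<Rightarrow> ('v \<Rightarrow> 'a) \<Rightarrow> 'v \<Rightarrow> 'a" where
  "scale1 c f = (\<lambda>i. c * f i)"

definition scale2 :: "'a::comm_ring_1 \<Rightarrow> ('v \<Rightarrow> 'v \<Rightarrow> 'a) \<Rightarrow> 'v \<Rightarrow> 'v \<Rightarrow> 'a" where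
  "scale2 c \<omega> = (\<lambda>i j. c * \<omega> i j)"

definition linear_map_on ::
  "'m set \<Rightarrow> ('a \<Rightarrow> 'm \<Rightarrow> 'm) \<Rightarrow> ('a \<Rightarrow> 'n \<Rightarrow> 'n) \<Rightarrow> ('m::plus \<Rightarrow> 'n::plus) \<Rightarrow> bool" where
  "linear_map_on S s t f \<longleftrightarrow>
     (\<forall>x\<in>S. \<forall>y\<in>S. f (x + y) = f x + f y) \<and> (\<forall>c. \<forall>x\<in>S. f (s c x) = t c (f x))"

definition bilinear_map_on ::
  "'m set \<Rightarrow> ('a \<Rightarrow> 'm \<Rightarrow> 'm) \<Rightarrow> ('a \<Rightarrow> 'n \<Rightarrow> 'n) \<Rightarrow> ('m::plus \<Rightarrow> 'm \<Rightarrow> 'n::plus) \<Rightarrow> bool" where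
  "bilinear_map_on S s t B \<longleftrightarrow>
     (\<forall>x\<in>S. linear_map_on S s t (B x)) \<and> (\<forall>y\<in>S. linear_map_on S s t (\<lambda>x. B x y))"

text \<open>
  The exterior square of \<open>R\<^sup>V\<close>, realised as the module of alternating \<open>V \<times> V\<close> matrices:
  \<open>\<omega>\<close> stands for the sum of \<open>\<omega> i j\<close> times \<open>e\<^sub>i \<and> e\<^sub>j\<close> over unordered pairs \<open>{i, j}\<close>. This is
  a model of the exterior square over every commutative ring; its universal property is proved below
  (\<open>ext2_universal\<close> and \<open>ext2_unique\<close>).
\<close>

definition ext2 :: "'v set \<Rightarrow> ('v \<Rightarrow> 'v \<Rightarrow> 'a::comm_ring_1) set" where
  "ext2 V = {\<omega>. (\<forall>i j. i \<notin> V \<or> j \<notin> V \<longrightarrow> \<omega> i j = 0) \<and>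
                (\<forall>i. \<omega> i i = 0) \<and> (\<forall>i j. \<omega> j i = - \<omega> i j)}"

definition wedge :: "('v \<Rightarrow> 'a::comm_ring_1) \<Rightarrow> ('v \<Rightarrow> 'a) \<Rightarrow> 'v \<Rightarrow> 'v \<Rightarrow> 'a" where
  "wedge u v = (\<lambda>i j. u i * v j - u j * v i)"

definition lie_algebra_on ::
  "'v set \<Rightarrow> (('v \<Rightarrow> 'a::comm_ring_1) \<Rightarrow> ('v \<Rightarrow> 'a) \<Rightarrow> 'v \<Rightarrow> 'a) \<Rightarrow> bool" where
  "lie_algebra_on V br \<longleftrightarrow>
     (\<forall>x\<in>free_mod V. \<forall>y\<in>free_mod V. br x y \<in> free_mod V) \<and>
     bilinear_map_on (free_mod V) scale1 scale1 br \<and>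
     (\<forall>x\<in>free_mod V. \<forall>y\<in>free_mod V. br x y = - br y x) \<and>
     (\<forall>x\<in>free_mod V. \<forall>y\<in>free_mod V. \<forall>z\<in>free_mod V.
        br x (br y z) + br y (br z x) + br z (br x y) = 0)"

text \<open>
  The extension of \<open>u \<and> v \<mapsto> [x,u] \<and> v + u \<and> [x,v]\<close> to the exterior square (see \<open>ad2_wedge\<close>):
  the restriction to alternating tensors of \<open>ad x \<otimes> 1 + 1 \<otimes> ad x\<close>.
\<close>

definition ad2 ::
  "'v set \<Rightarrow> (('v \<Rightarrow> 'a::comm_ring_1) \<Rightarrow> ('v \<Rightarrow> 'a) \<Rightarrow> 'v \<Rightarrow> 'a) \<Rightarrow>
   ('v \<Rightarrow> 'a) \<Rightarrow> ('v \<Rightarrow> 'v \<Rightarrow> 'a) \<Rightarrow> 'v \<Rightarrow> 'v \<Rightarrow> 'a" where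
  "ad2 V br x \<omega> =
     (\<lambda>a b. \<Sum>k\<in>V. br x (basis_vec k) a * \<omega> k b + \<omega> a k * br x (basis_vec k) b)"

definition dual_mod :: "'v set \<Rightarrow> (('v \<Rightarrow> 'a::comm_ring_1) \<Rightarrow> 'a) set" where
  "dual_mod V = {\<xi>. linear_map_on (free_mod V) scale1 (*) \<xi>}"

text \<open>
  The pairing of \<open>\<xi> \<and> \<eta>\<close> with the exterior square, i.e. the linear extension of
  \<open>u \<and> v \<mapsto> \<xi> u * \<eta> v - \<xi> v * \<eta> u\<close> (see \<open>pairing2_wedge\<close>).
\<close>

definition pairing2 ::
  "'v set \<Rightarrow> (('v \<Rightarrow> 'a::comm_ring_1) \<Rightarrow> 'a) \<Rightarrow> (('v \<Rightarrow> 'a) \<Rightarrow> 'a) \<Rightarrow> ('v \<Rightarrow> 'v \<Rightarrow> 'a) \<Rightarrow> 'a" where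
  "pairing2 V \<xi> \<eta> \<omega> = (\<Sum>i\<in>V. \<Sum>j\<in>V. \<omega> i j * \<xi> (basis_vec i) * \<eta> (basis_vec j))"

definition dual_bracket ::
  "'v set \<Rightarrow> (('v \<Rightarrow> 'a::comm_ring_1) \<Rightarrow> 'v \<Rightarrow> 'v \<Rightarrow> 'a) \<Rightarrow>
   (('v \<Rightarrow> 'a) \<Rightarrow> 'a) \<Rightarrow> (('v \<Rightarrow> 'a) \<Rightarrow> 'a) \<Rightarrow> ('v \<Rightarrow> 'a) \<Rightarrow> 'a" where
  "dual_bracket V \<delta> \<xi> \<eta> = (\<lambda>x. pairing2 V \<xi> \<eta> (\<delta> x))"

text \<open>
  Functionals only matter on \<open>free_mod V\<close>, so identities in the dual are tested there.
\<close>

definition co_jacobi :: "'v set \<Rightarrow> (('v \<Rightarrow> 'a::comm_ring_1) \<Rightarrow> 'v \<Rightarrow> 'v \<Rightarrow> 'a) \<Rightarrow> bool" where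
  "co_jacobi V \<delta> \<longleftrightarrow>
     (\<forall>\<xi>\<in>dual_mod V. \<forall>\<eta>\<in>dual_mod V. \<forall>\<zeta>\<in>dual_mod V. \<forall>x\<in>free_mod V.
        dual_bracket V \<delta> \<xi> (dual_bracket V \<delta> \<eta> \<zeta>) x +
        dual_bracket V \<delta> \<eta> (dual_bracket V \<delta> \<zeta> \<xi>) x +
        dual_bracket V \<delta> \<zeta> (dual_bracket V \<delta> \<xi> \<eta>) x = 0)"

definition cocycle ::
  "'v set \<Rightarrow> (('v \<Rightarrow> 'a::comm_ring_1) \<Rightarrow> ('v \<Rightarrow> 'a) \<Rightarrow> 'v \<Rightarrow> 'a) \<Rightarrow>
   (('v \<Rightarrow> 'a) \<Rightarrow> 'v \<Rightarrow> 'v \<Rightarrow> 'a) \<Rightarrow> bool" where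
  "cocycle V br \<delta> \<longleftrightarrow>
     (\<forall>x\<in>free_mod V. \<forall>y\<in>free_mod V. \<delta> (br x y) = ad2 V br x (\<delta> y) - ad2 V br y (\<delta> x))"

definition lie_bialgebra_on ::
  "'v set \<Rightarrow> (('v \<Rightarrow> 'a::comm_ring_1) \<Rightarrow> ('v \<Rightarrow> 'a) \<Rightarrow> 'v \<Rightarrow> 'a) \<Rightarrow>
   (('v \<Rightarrow> 'a) \<Rightarrow> 'v \<Rightarrow> 'v \<Rightarrow> 'a) \<Rightarrow> bool" where
  "lie_bialgebra_on V br \<delta> \<longleftrightarrow>
     lie_algebra_on V br \<and>
     (\<forall>x\<in>free_mod V. \<delta> x \<in> ext2 V) \<and> linear_map_on (free_mod V) scale1 scale2 \<delta> \<and>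
     co_jacobi V \<delta> \<and> cocycle V br \<delta>"

definition weight_bracket ::
  "'v set \<Rightarrow> ('v \<Rightarrow> 'v \<Rightarrow> 'a::comm_ring_1) \<Rightarrow> ('v \<Rightarrow> 'a) \<Rightarrow> ('v \<Rightarrow> 'a) \<Rightarrow> 'v \<Rightarrow> 'a" where
  "weight_bracket V w f g = (\<lambda>i. \<Sum>j\<in>V. w i j * (f i * g j - f j * g i))"

definition weight_cobracket ::
  "'v set \<Rightarrow> ('v \<Rightarrow> 'v \<Rightarrow> 'a::comm_ring_1) \<Rightarrow> ('v \<Rightarrow> 'a) \<Rightarrow> 'v \<Rightarrow> 'v \<Rightarrow> 'a" where
  "weight_cobracket V w f =
     (\<Sum>i\<in>V. scale2 (f i) (\<Sum>j\<in>V. scale2 (w i j) (wedge (basis_vec i) (basis_vec j))))"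

lemma sum_fun_apply: "(\<Sum>i\<in>A. f i) x = (\<Sum>i\<in>A. f i x)"
  by (induction A rule: infinite_finite_induct) auto

lemma free_mod_expand:
  assumes "finite V" "u \<in> free_mod V"
  shows "u = (\<Sum>i\<in>V. scale1 (u i) (basis_vec i))"
proof
  fix k
  have "(\<Sum>i\<in>V. scale1 (u i) (basis_vec i)) k = (\<Sum>i\<in>V. if k = i then u i else 0)"
    unfolding sum_fun_apply by (intro sum.cong) (auto simp: scale1_def basis_vec_def)
  also have "\<dots> = u k"
    using assms by (auto simp: free_mod_def)
  finally show "u k = (\<Sum>i\<in>V. scale1 (u i) (basis_vec i)) k" ..
qed

lemma basis_vec_in: "i \<in> V \<Longrightarrow> basis_vec i \<in> free_mod V"
  by (auto simp: free_mod_def basis_vec_def)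

lemma linear_map_on_sum:
  fixes f :: "'m::comm_monoid_add \<Rightarrow> 'n::ab_group_add"
  assumes "linear_map_on S s t f" "finite A" "0 \<in> S" "\<And>x y. x \<in> S \<Longrightarrow> y \<in> S \<Longrightarrow> x + y \<in> S"
    and "\<And>i. i \<in> A \<Longrightarrow> g i \<in> S"
  shows "(\<Sum>i\<in>A. g i) \<in> S \<and> f (\<Sum>i\<in>A. g i) = (\<Sum>i\<in>A. f (g i))"
  using assms(2,5)
proof (induction A rule: finite_induct)
  case empty
  have "f (0 + 0) = f 0 + f 0"
    using assms(1,3) unfolding linear_map_on_def by blast
  then show ?case using assms(3) by simp
next
  case (insert i A)
  then show ?case
    using assms(1,4) by (simp add: linear_map_on_def)
qed

lemma linear_map_on_free_mod_expand:
  fixes f :: "('v \<Rightarrow> 'a::comm_ring_1) \<Rightarrow> 'n::ab_group_add"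
  assumes "linear_map_on (free_mod V) scale1 t f" "finite V" "u \<in> free_mod V"
  shows "f u = (\<Sum>i\<in>V. t (u i) (f (basis_vec i)))"
proof -
  have "f (\<Sum>i\<in>V. scale1 (u i) (basis_vec i)) = (\<Sum>i\<in>V. f (scale1 (u i) (basis_vec i)))"
    using linear_map_on_sum[OF assms(1,2), of "\<lambda>i. scale1 (u i) (basis_vec i)"]
    by (auto simp: free_mod_def scale1_def basis_vec_def)
  also have "\<dots> = (\<Sum>i\<in>V. t (u i) (f (basis_vec i)))"
    using assms(1) by (intro sum.cong) (auto simp: linear_map_on_def basis_vec_in)
  finally show ?thesis
    using free_mod_expand[OF assms(2,3)] by simp
qed

lemma wedge_in_ext2: "u \<in> free_mod V \<Longrightarrow> v \<in> free_mod V \<Longrightarrow> wedge u v \<in> ext2 V"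
  by (auto simp: ext2_def wedge_def free_mod_def)

lemma wedge_bilinear: "bilinear_map_on (free_mod V) scale1 scale2 wedge"
  by (auto simp: bilinear_map_on_def linear_map_on_def wedge_def scale1_def scale2_def
      fun_eq_iff algebra_simps)

lemma wedge_self: "wedge u u = 0"
  by (auto simp: wedge_def fun_eq_iff algebra_simps)

lemma ext2_zero: "0 \<in> ext2 V"
  by (simp add: ext2_def)

lemma ext2_add: "\<omega> \<in> ext2 V \<Longrightarrow> \<omega>' \<in> ext2 V \<Longrightarrow> \<omega> + \<omega>' \<in> ext2 V"
  unfolding ext2_def mem_Collect_eq plus_fun_apply by (metis add_0 minus_add_distrib)

lemma ext2_scale: "\<omega> \<in> ext2 V \<Longrightarrow> scale2 c \<omega> \<in> ext2 V"
  unfolding ext2_def scale2_def mem_Collect_eq by (metis mult_minus_right mult_zero_right)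

lemma ext2_expand:
  fixes \<omega> :: "'v \<Rightarrow> 'v \<Rightarrow> 'a::comm_ring_1" and h :: "'v \<Rightarrow> nat"
  assumes "finite V" "inj_on h V" "\<omega> \<in> ext2 V"
  shows "\<omega> = (\<Sum>p | p \<in> V \<times> V \<and> h (fst p) < h (snd p).
                scale2 (\<omega> (fst p) (snd p)) (wedge (basis_vec (fst p)) (basis_vec (snd p))))"
    (is "_ = (\<Sum>p\<in>?P. ?f p)")
proof (intro ext)
  fix a b
  have fin: "finite ?P" using assms(1) by (auto intro: finite_subset[of _ "V \<times> V"])
  have anti: "\<omega> j i = - \<omega> i j" and diag: "\<omega> i i = 0" for i j
    using assms(3) unfolding ext2_def by blast+
  have "(\<Sum>p\<in>?P. ?f p) a b = (\<Sum>p\<in>?P. ?f p a b)"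
    by (simp add: sum_fun_apply)
  also have "\<dots> = (\<Sum>p\<in>?P. (if p = (a, b) then \<omega> a b else 0) - (if p = (b, a) then \<omega> b a else 0))"
  proof (intro sum.cong refl)
    fix p assume "p \<in> ?P"
    then have ne: "fst p \<noteq> snd p" by auto
    consider "p = (a, b)" | "p = (b, a)" | "p \<noteq> (a, b)" "p \<noteq> (b, a)" by blast
    then show "?f p a b = (if p = (a, b) then \<omega> a b else 0) - (if p = (b, a) then \<omega> b a else 0)"
    proof cases
      case 3
      then have "wedge (basis_vec (fst p)) (basis_vec (snd p)) a b = (0::'a)"
        unfolding wedge_def basis_vec_def by (cases p) auto
      with 3 show ?thesis by (simp add: scale2_def)
    qed (use ne in \<open>auto simp: scale2_def wedge_def basis_vec_def\<close>)
  qed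
  also have "\<dots> = (if (a, b) \<in> ?P then \<omega> a b else 0) - (if (b, a) \<in> ?P then \<omega> b a else 0)"
    using fin by (simp add: sum_subtractf)
  also have "\<dots> = \<omega> a b"
  proof (cases "a \<in> V \<and> b \<in> V")
    case True
    then show ?thesis
      using assms(2) diag[of a] anti[of a b]
      by (cases "h a" "h b" rule: linorder_cases) (auto dest: inj_onD)
  next
    case False
    then have "\<omega> a b = 0" "\<omega> b a = 0" using assms(3) unfolding ext2_def by blast+
    then show ?thesis by simp
  qed
  finally show "\<omega> a b = (\<Sum>p\<in>?P. ?f p) a b" ..
qed

theorem ext2_unique:
  fixes T T' :: "('v \<Rightarrow> 'v \<Rightarrow> 'a::comm_ring_1) \<Rightarrow> 'm::ab_group_add"
  assumes "finite V"
    and "linear_map_on (ext2 V) scale2 s T" "linear_map_on (ext2 V) scale2 s T'"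
    and "\<And>u v. u \<in> free_mod V \<Longrightarrow> v \<in> free_mod V \<Longrightarrow> T (wedge u v) = T' (wedge u v)"
    and "\<omega> \<in> ext2 V"
  shows "T \<omega> = T' \<omega>"
proof -
  obtain h :: "'v \<Rightarrow> nat" where h: "inj_on h V"
    using assms(1) finite_imp_inj_to_nat_seg by metis
  define P where "P = {p \<in> V \<times> V. h (fst p) < h (snd p)}"
  define g where "g p = wedge (basis_vec (fst p)) (basis_vec (snd p) :: 'v \<Rightarrow> 'a)" for p
  have fin: "finite P" using assms(1) by (auto simp: P_def intro: finite_subset[of _ "V \<times> V"])
  have \<omega>: "\<omega> = (\<Sum>p\<in>P. scale2 (\<omega> (fst p) (snd p)) (g p))"
    using ext2_expand[OF assms(1) h assms(5)] by (simp add: P_def g_def)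
  have gin: "g p \<in> ext2 V" if "p \<in> P" for p
    using that by (auto simp: P_def g_def intro!: wedge_in_ext2 basis_vec_in)
  have sin: "scale2 c (g p) \<in> ext2 V" if "p \<in> P" for p c
    using ext2_scale gin[OF that] .
  have T: "F \<omega> = (\<Sum>p\<in>P. s (\<omega> (fst p) (snd p)) (F (g p)))"
    if F: "linear_map_on (ext2 V) scale2 s F" for F :: "('v \<Rightarrow> 'v \<Rightarrow> 'a) \<Rightarrow> 'm"
  proof -
    have "F (\<Sum>p\<in>P. scale2 (\<omega> (fst p) (snd p)) (g p)) =
          (\<Sum>p\<in>P. F (scale2 (\<omega> (fst p) (snd p)) (g p)))"
      using linear_map_on_sum[OF F fin, of "\<lambda>p. scale2 (\<omega> (fst p) (snd p)) (g p)"]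
        ext2_zero ext2_add sin by blast
    also have "\<dots> = (\<Sum>p\<in>P. s (\<omega> (fst p) (snd p)) (F (g p)))"
      using F gin by (intro sum.cong) (auto simp: linear_map_on_def)
    finally show ?thesis using \<omega> by simp
  qed
  have "T (g p) = T' (g p)" if "p \<in> P" for p
    using that by (auto simp: P_def g_def intro!: assms(4) basis_vec_in)
  then show ?thesis
    unfolding T[OF assms(2)] T[OF assms(3)] by (intro sum.cong) auto
qed

theorem ext2_universal:
  fixes B :: "('v \<Rightarrow> 'a::comm_ring_1) \<Rightarrow> ('v \<Rightarrow> 'a) \<Rightarrow> 'm::ab_group_add"
  assumes "finite V" "module s" "bilinear_map_on (free_mod V) scale1 s B"
    and alt: "\<And>u. u \<in> free_mod V \<Longrightarrow> B u u = 0"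
  shows "\<exists>T. linear_map_on (ext2 V) scale2 s T \<and>
             (\<forall>u\<in>free_mod V. \<forall>v\<in>free_mod V. T (wedge u v) = B u v)"
proof -
  interpret module s by fact
  obtain h :: "'v \<Rightarrow> nat" where h: "inj_on h V"
    using assms(1) finite_imp_inj_to_nat_seg by metis
  define P where "P = {p \<in> V \<times> V. h (fst p) < h (snd p)}"
  define Q where "Q = {p \<in> V \<times> V. h (snd p) < h (fst p)}"
  define D where "D = {p \<in> V \<times> V. fst p = snd p}"
  define b where "b i j = B (basis_vec i) (basis_vec j)" for i j
  define T where "T \<omega> = (\<Sum>p\<in>P. s (\<omega> (fst p) (snd p)) (b (fst p) (snd p)))" for \<omega>
  have fin: "finite P" "finite Q" "finite D"
    using assms(1) by (auto simp: P_def Q_def D_def intro: finite_subset[of _ "V \<times> V"])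
  have bdiag: "b i i = 0" if "i \<in> V" for i
    using that alt by (simp add: b_def basis_vec_in)
  have lin1: "linear_map_on (free_mod V) scale1 s (B u)" if "u \<in> free_mod V" for u
    using assms(3) that by (auto simp: bilinear_map_on_def)
  have lin2: "linear_map_on (free_mod V) scale1 s (\<lambda>u. B u v)" if "v \<in> free_mod V" for v
    using assms(3) that by (auto simp: bilinear_map_on_def)
  have banti: "b j i = - b i j" if "i \<in> V" "j \<in> V" for i j
  proof -
    let ?i = "basis_vec i :: 'v \<Rightarrow> 'a" and ?j = "basis_vec j :: 'v \<Rightarrow> 'a"
    have m: "?i \<in> free_mod V" "?j \<in> free_mod V" "?i + ?j \<in> free_mod V"
      using that by (auto simp: free_mod_def basis_vec_def)
    have "0 = B (?i + ?j) (?i + ?j)" using alt m by simp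
    also have "\<dots> = B ?i (?i + ?j) + B ?j (?i + ?j)"
      using lin2[OF m(3)] m by (simp add: linear_map_on_def)
    also have "\<dots> = b i j + b j i"
      using lin1 m alt by (simp add: linear_map_on_def b_def)
    finally show ?thesis by (metis add_eq_0_iff)
  qed
  have Twedge: "T (wedge u v) = B u v" if u: "u \<in> free_mod V" and v: "v \<in> free_mod V" for u v
  proof -
    let ?c = "\<lambda>p. s (u (fst p) * v (snd p)) (b (fst p) (snd p))"
    have "B u v = (\<Sum>i\<in>V. s (u i) (B (basis_vec i) v))"
      using linear_map_on_free_mod_expand[OF lin2[OF v] assms(1) u] .
    also have "\<dots> = (\<Sum>i\<in>V. \<Sum>j\<in>V. s (u i * v j) (b i j))"
      by (intro sum.cong refl)
        (simp add: linear_map_on_free_mod_expand[OF lin1 assms(1) v] basis_vec_in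
          scale_sum_right b_def)
    also have "\<dots> = sum ?c (V \<times> V)"
      by (simp add: sum.cartesian_product case_prod_unfold)
    also have "V \<times> V = (P \<union> Q) \<union> D"
      using h by (auto simp: P_def Q_def D_def inj_on_def) (metis linorder_neqE_nat)
    also have "sum ?c ((P \<union> Q) \<union> D) = sum ?c P + sum ?c Q + sum ?c D"
      using fin by (subst sum.union_disjoint, auto simp: P_def Q_def D_def)
        (subst sum.union_disjoint, auto)
    also have "sum ?c D = 0"
      by (intro sum.neutral) (auto simp: D_def bdiag)
    also have "sum ?c Q = (\<Sum>p\<in>P. ?c (prod.swap p))"
      by (rule sum.reindex_bij_witness[of _ prod.swap prod.swap]) (auto simp: P_def Q_def)
    also have "\<dots> = (\<Sum>p\<in>P. - s (u (snd p) * v (fst p)) (b (fst p) (snd p)))"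
      proof (intro sum.cong refl)
      fix p assume "p \<in> P"
      then have "b (snd p) (fst p) = - b (fst p) (snd p)"
        by (intro banti) (auto simp: P_def)
      then show "?c (prod.swap p) = - s (u (snd p) * v (fst p)) (b (fst p) (snd p))"
        by simp
    qed
    finally show ?thesis
      by (simp add: T_def wedge_def scale_left_diff_distrib sum_subtractf sum_negf)
  qed
  have "linear_map_on (ext2 V) scale2 s T"
    by (auto simp: linear_map_on_def T_def scale2_def scale_left_distrib sum.distrib
        scale_sum_right)
  with Twedge show ?thesis by blast
qed

lemma pairing2_wedge:
  assumes "finite V" "\<xi> \<in> dual_mod V" "\<eta> \<in> dual_mod V" "u \<in> free_mod V" "v \<in> free_mod V"
  shows "pairing2 V \<xi> \<eta> (wedge u v) = \<xi> u * \<eta> v - \<xi> v * \<eta> u"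
proof -
  have e: "\<zeta> x = (\<Sum>i\<in>V. x i * \<zeta> (basis_vec i))"
    if "\<zeta> \<in> dual_mod V" "x \<in> free_mod V" for \<zeta> x
    using linear_map_on_free_mod_expand that assms(1) by (auto simp: dual_mod_def)
  show ?thesis
    unfolding e[OF assms(2,4)] e[OF assms(3,5)] e[OF assms(2,5)] e[OF assms(3,4)] sum_product
    by (simp add: pairing2_def wedge_def sum_subtractf left_diff_distrib right_diff_distrib mult_ac)
qed

lemma pairing2_linear: "linear_map_on (ext2 V) scale2 (*) (pairing2 V \<xi> \<eta>)"
  by (simp add: linear_map_on_def pairing2_def scale2_def sum.distrib sum_distrib_left
      distrib_right mult.assoc)

lemma ad2_wedge:
  assumes "finite V" "bilinear_map_on (free_mod V) scale1 scale1 br"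
    and "x \<in> free_mod V" "u \<in> free_mod V" "v \<in> free_mod V"
  shows "ad2 V br x (wedge u v) = wedge (br x u) v + wedge u (br x v)"
proof (intro ext)
  fix a b
  have e: "br x y c = (\<Sum>k\<in>V. y k * br x (basis_vec k) c)" if "y \<in> free_mod V" for y c
  proof -
    have "linear_map_on (free_mod V) scale1 scale1 (br x)"
      using assms(2,3) by (auto simp: bilinear_map_on_def)
    from linear_map_on_free_mod_expand[OF this assms(1) that]
    have "br x y c = (\<Sum>k\<in>V. scale1 (y k) (br x (basis_vec k))) c" by simp
    then show ?thesis by (simp add: sum_fun_apply scale1_def)
  qed
  have "ad2 V br x (wedge u v) a b =
      (\<Sum>k\<in>V. u k * br x (basis_vec k) a * v b - u b * (v k * br x (basis_vec k) a)
        + (u a * (v k * br x (basis_vec k) b) - u k * br x (basis_vec k) b * v a))"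
    unfolding ad2_def wedge_def by (intro sum.cong refl) (simp add: algebra_simps)
  also have "\<dots> = (wedge (br x u) v + wedge u (br x v)) a b"
    by (simp add: sum.distrib sum_subtractf wedge_def e[OF assms(4)] e[OF assms(5)]
        sum_distrib_left sum_distrib_right)
  finally show "ad2 V br x (wedge u v) a b = (wedge (br x u) v + wedge u (br x v)) a b" .
qed

lemma ad2_linear: "linear_map_on (ext2 V) scale2 scale2 (ad2 V br x)"
  unfolding linear_map_on_def ad2_def scale2_def fun_eq_iff plus_fun_apply
    sum_distrib_left sum.distrib[symmetric]
  by (intro conjI ballI allI sum.cong refl) (simp_all add: algebra_simps)

lemma weight_cobracket_basis_vec:
  assumes "finite V" "i \<in> V"
  shows "weight_cobracket V w (basis_vec i) =
    (\<Sum>j\<in>V. scale2 (w i j) (wedge (basis_vec i) (basis_vec j)))"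
proof -
  have "weight_cobracket V w (basis_vec i) =
      (\<Sum>k\<in>V. if k = i then \<Sum>j\<in>V. scale2 (w k j) (wedge (basis_vec k) (basis_vec j)) else 0)"
    unfolding weight_cobracket_def
    by (intro sum.cong refl) (auto simp: scale2_def basis_vec_def fun_eq_iff)
  then show ?thesis using assms by simp
qed

end

theory Submission
  imports Defs
begin

text \<open>
  On basis vectors \<open>[e\<^sub>a, e\<^sub>b] = w\<^sub>a\<^sub>b (e\<^sub>a - e\<^sub>b)\<close>. For distinct \<open>a\<close>, \<open>b\<close>, \<open>c\<close> the \<open>e\<^sub>a\<close>-component of the
  Jacobi identity is \<open>w\<^sub>b\<^sub>c (w\<^sub>a\<^sub>b - w\<^sub>a\<^sub>c) = 0\<close>, and the \<open>e\<^sub>a \<and> e\<^sub>c\<close>-component of the cocycle condition on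
  \<open>e\<^sub>a, e\<^sub>b\<close> is \<open>w\<^sub>b\<^sub>c (w\<^sub>a\<^sub>b + w\<^sub>a\<^sub>c) = 0\<close>; adding them and cancelling 2 gives necessity.
  Conversely, write \<open>[f, g]\<^sub>i = f\<^sub>i (W g)\<^sub>i - g\<^sub>i (W f)\<^sub>i\<close> for the weight matrix \<open>W\<close>. The orthogonality of
  the weights gives \<open>w\<^sub>i\<^sub>j (W f)\<^sub>j = w\<^sub>i\<^sub>j\<^sup>2 f\<^sub>i\<close>, from which the Jacobi and cocycle identities follow
  by expansion, and the dual bracket is the same bracket on coordinates, so that co-Jacobi is Jacobi.
\<close>

section \<open>Coordinate formulas for the bracket, the cobracket, the dual bracket and
  \<open>ad2\<close>\<close>

definition weight_op :: "'v set \<Rightarrow> ('v \<Rightarrow> 'v \<Rightarrow> 'a::comm_ring_1) \<Rightarrow> ('v \<Rightarrow> 'a) \<Rightarrow> 'v \<Rightarrow> 'a" where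
  "weight_op V w f i = (\<Sum>j\<in>V. w i j * f j)"

lemma weight_op_basis_vec:
  "finite V \<Longrightarrow> k \<in> V \<Longrightarrow> weight_op V w (basis_vec k) i = w i k"
  by (simp add: weight_op_def basis_vec_def if_distrib cong: if_cong)

lemma weight_op_add: "weight_op V w (f + g) i = weight_op V w f i + weight_op V w g i"
  by (simp add: weight_op_def distrib_left sum.distrib)

lemma weight_op_scale1: "weight_op V w (scale1 c f) i = c * weight_op V w f i"
  by (simp add: weight_op_def scale1_def sum_distrib_left mult_ac)

lemma weight_bracket_eq:
  "weight_bracket V w f g i = f i * weight_op V w g i - g i * weight_op V w f i"
  by (simp add: weight_bracket_def weight_op_def sum_distrib_left right_diff_distrib
      sum_subtractf mult_ac)

lemma weight_bracket_basis_vec: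
  assumes "finite V" "k \<in> V"
  shows "weight_bracket V w x (basis_vec k) i =
    x i * w i k - (if i = k then weight_op V w x i else 0)"
  using assms by (simp add: weight_bracket_eq weight_op_basis_vec) (simp add: basis_vec_def)

lemma weight_bracket_in_free_mod:
  "x \<in> free_mod V \<Longrightarrow> y \<in> free_mod V \<Longrightarrow> weight_bracket V w x y \<in> free_mod V"
  by (simp add: free_mod_def weight_bracket_eq)

lemma weight_bracket_bilinear:
  "bilinear_map_on (free_mod V) scale1 scale1 (weight_bracket V w)"
  unfolding bilinear_map_on_def linear_map_on_def
  by (simp add: fun_eq_iff weight_bracket_eq weight_op_add weight_op_scale1)
    (simp add: scale1_def weight_bracket_eq algebra_simps)

text \<open>The entry \<open>(a, b)\<close> receives \<open>f a * w a b\<close> from the summand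
  \<open>i = a\<close> and \<open>- f b * w b a\<close> from \<open>i = b\<close>, and symmetry of
  \<open>w\<close> merges the two. Later arguments use this entry formula instead of sums of
  wedges.\<close>

lemma weight_cobracket_apply:
  assumes "finite V" "\<And>i j. i \<in> V \<Longrightarrow> j \<in> V \<Longrightarrow> w i j = w j i"
  shows "weight_cobracket V w f a b = (if a \<in> V \<and> b \<in> V then w a b * (f a - f b) else 0)"
proof -
  have "weight_cobracket V w f a b = (\<Sum>i\<in>V. \<Sum>j\<in>V.
      (if i = a then if j = b then f a * w a b else 0 else 0) -
      (if i = b then if j = a then f b * w b a else 0 else 0))"
    unfolding weight_cobracket_def
    by (auto simp: sum_fun_apply scale2_def wedge_def basis_vec_def sum_distrib_left
        intro!: sum.cong)
  also have "\<dots> = (\<Sum>i\<in>V. (if i = a then if b \<in> V then f a * w a b else 0 else 0) -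
      (if i = b then if a \<in> V then f b * w b a else 0 else 0))"
    using assms(1) by (intro sum.cong refl) (auto simp: sum_subtractf)
  also have "\<dots> = (if a \<in> V \<and> b \<in> V then w a b * (f a - f b) else 0)"
    using assms by (auto simp: sum_subtractf algebra_simps)
  finally show ?thesis .
qed

lemma weight_cobracket_in_ext2:
  assumes "finite V" "\<And>i j. i \<in> V \<Longrightarrow> j \<in> V \<Longrightarrow> w i j = w j i"
  shows "weight_cobracket V w f \<in> ext2 V"
  unfolding ext2_def using assms(2)
  by (auto simp: weight_cobracket_apply[OF assms] algebra_simps)

lemma weight_cobracket_linear:
  assumes "finite V" "\<And>i j. i \<in> V \<Longrightarrow> j \<in> V \<Longrightarrow> w i j = w j i"
  shows "linear_map_on S scale1 scale2 (weight_cobracket V w)"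
  by (auto simp: linear_map_on_def fun_eq_iff weight_cobracket_apply[OF assms] scale1_def
      scale2_def algebra_simps)

lemma dual_bracket_weight_cobracket:
  assumes "finite V" "\<And>i j. i \<in> V \<Longrightarrow> j \<in> V \<Longrightarrow> w i j = w j i"
  shows "dual_bracket V (weight_cobracket V w) \<xi> \<eta> x =
    (\<Sum>i\<in>V. x i * weight_bracket V w (\<lambda>i. \<xi> (basis_vec i)) (\<lambda>i. \<eta> (basis_vec i)) i)"
proof -
  let ?x = "\<lambda>i. \<xi> (basis_vec i)" and ?y = "\<lambda>i. \<eta> (basis_vec i)"
  have "dual_bracket V (weight_cobracket V w) \<xi> \<eta> x =
      (\<Sum>i\<in>V. \<Sum>j\<in>V. x i * (w i j * ?x i * ?y j) - x j * (w j i * ?x i * ?y j))"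
    unfolding dual_bracket_def pairing2_def
    by (intro sum.cong refl) (use assms(2) in \<open>simp add: weight_cobracket_apply[OF assms] algebra_simps\<close>)
  \<comment> \<open>Exchanging the order of summation in the second half only makes \<open>x\<close>
    carry the outer index in both halves, so the coefficient of each \<open>x i\<close> can be read
    off.\<close>
  also have "\<dots> = (\<Sum>i\<in>V. \<Sum>j\<in>V. x i * (w i j * ?x i * ?y j)) -
      (\<Sum>j\<in>V. \<Sum>i\<in>V. x j * (w j i * ?x i * ?y j))"
    by (simp add: sum_subtractf) (rule sum.swap)
  also have "\<dots> = (\<Sum>i\<in>V. x i * weight_bracket V w ?x ?y i)"
    unfolding sum_subtractf[symmetric] weight_bracket_def sum_distrib_left
    by (intro sum.cong refl) (simp add: algebra_simps)
  finally show ?thesis .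
qed

text \<open>Bracketing with \<open>x\<close> has matrix entries \<open>x i * w i k\<close> minus the
  diagonal \<open>weight_op V w x\<close>. The diagonal produces the last term. The rest produces
  sums over paths \<open>a\<close>, \<open>k\<close>, \<open>b\<close>: orthogonal weights kill
  these when \<open>a\<close> and \<open>b\<close> differ, and one such path yields a term of the
  necessity proof.\<close>

lemma ad2_weight_cobracket:
  assumes "finite V" "\<And>i j. i \<in> V \<Longrightarrow> j \<in> V \<Longrightarrow> w i j = w j i" "a \<in> V" "b \<in> V"
  shows "ad2 V (weight_bracket V w) x (weight_cobracket V w y) a b =
    x a * (\<Sum>k\<in>V. w k a * w k b * (y k - y b)) + x b * (\<Sum>k\<in>V. w k a * w k b * (y a - y k))
    - (weight_op V w x a + weight_op V w x b) * w a b * (y a - y b)"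
proof -
  have "ad2 V (weight_bracket V w) x (weight_cobracket V w y) a b =
    (\<Sum>k\<in>V. x a * (w k a * w k b * (y k - y b)) + x b * (w k a * w k b * (y a - y k))
      - (if a = k then weight_op V w x a * w a b * (y a - y b) else 0)
      - (if b = k then weight_op V w x b * w a b * (y a - y b) else 0))"
    unfolding ad2_def
    by (intro sum.cong refl)
      (auto simp: weight_cobracket_apply[OF assms(1,2)] weight_bracket_basis_vec[OF assms(1)]
        assms(2)[OF assms(3)] assms(2)[OF assms(4)] assms(3,4) algebra_simps)
  also have "\<dots> = x a * (\<Sum>k\<in>V. w k a * w k b * (y k - y b))
      + x b * (\<Sum>k\<in>V. w k a * w k b * (y a - y k))
      - weight_op V w x a * w a b * (y a - y b) - weight_op V w x b * w a b * (y a - y b)"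
    using assms(1,3,4) by (simp add: sum.distrib sum_subtractf sum_distrib_left)
  finally show ?thesis by (simp add: algebra_simps)
qed

text \<open>Each summand vanishes separately: on the diagonal because the cobracket is an
  alternating matrix, and off \<open>V\<close> by support. This settles the entries of the cocycle
  identity at which no orthogonality argument is made.\<close>

lemma ad2_weight_cobracket_eq_0:
  assumes "finite V" "\<And>i j. i \<in> V \<Longrightarrow> j \<in> V \<Longrightarrow> w i j = w j i" "x \<in> free_mod V"
    and "a \<notin> V \<or> b \<notin> V \<or> a = b"
  shows "ad2 V (weight_bracket V w) x (weight_cobracket V w y) a b = 0"
proof -
  have x: "x i = 0" if "i \<notin> V" for i
    using assms(3) that by (simp add: free_mod_def)
  show ?thesis
    unfolding ad2_def
    by (intro sum.neutral)
      (use assms(2,4) x in \<open>auto simp: weight_cobracket_apply[OF assms(1,2)]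
        weight_bracket_basis_vec[OF assms(1)] algebra_simps\<close>)
qed

section \<open>Sufficiency: orthogonal weights give a Lie bialgebra\<close>

lemma weight_op_orthogonal:
  assumes "finite V" "i \<in> V" "j \<in> V" "\<And>i j. i \<in> V \<Longrightarrow> j \<in> V \<Longrightarrow> w i j = w j i"
    and "\<forall>i\<in>V. \<forall>j\<in>V. \<forall>k\<in>V. j \<noteq> k \<longrightarrow> w i j * w i k = 0"
  shows "w i j * weight_op V w f j = w i j * w i j * f i"
proof -
  have "w i j * weight_op V w f j = (\<Sum>k\<in>V. if k = i then w i j * w i j * f i else 0)"
    unfolding weight_op_def sum_distrib_left
  proof (intro sum.cong refl)
    fix k assume "k \<in> V"
    \<comment> \<open>Orthogonality is applied in row \<open>j\<close>, where \<open>w j i\<close>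
      annihilates every other weight; only \<open>k = i\<close> survives.\<close>
    have "w j i * w j k = 0" if "k \<noteq> i"
      using assms(2,3,5) \<open>k \<in> V\<close> that by auto
    then show "w i j * (w j k * f k) = (if k = i then w i j * w i j * f i else 0)"
      using assms(4)[OF assms(2,3)] by (auto simp flip: mult.assoc)
  qed
  then show ?thesis using assms(1,2) by simp
qed

text \<open>The identity is stated at points of \<open>V\<close> for arbitrary functions, so that it
  also applies to the coordinates of functionals, which need not vanish off
  \<open>V\<close>.\<close>

lemma weight_bracket_jacobi:
  assumes "finite V" "i \<in> V" "\<And>i j. i \<in> V \<Longrightarrow> j \<in> V \<Longrightarrow> w i j = w j i"
    and "\<forall>i\<in>V. \<forall>j\<in>V. \<forall>k\<in>V. j \<noteq> k \<longrightarrow> w i j * w i k = 0"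
  shows "weight_bracket V w x (weight_bracket V w y z) i
    + weight_bracket V w y (weight_bracket V w z x) i
    + weight_bracket V w z (weight_bracket V w x y) i = 0"
proof -
  let ?U = "\<lambda>f. \<Sum>j\<in>V. w i j * w i j * f j"
  have op: "weight_op V w (weight_bracket V w f g) i = g i * ?U f - f i * ?U g" for f g
  proof -
    have "weight_op V w (weight_bracket V w f g) i =
        (\<Sum>j\<in>V. f j * (w i j * weight_op V w g j) - g j * (w i j * weight_op V w f j))"
      unfolding weight_op_def[of V w "weight_bracket V w f g"]
      by (simp add: weight_bracket_eq algebra_simps)
    also have "\<dots> = (\<Sum>j\<in>V. f j * (w i j * w i j * g i) - g j * (w i j * w i j * f i))"
      using weight_op_orthogonal[OF assms(1,2) _ assms(3,4)] by (intro sum.cong refl) simp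
    also have "\<dots> = g i * ?U f - f i * ?U g"
      by (simp add: sum_subtractf sum_distrib_left mult_ac)
    finally show ?thesis .
  qed
  \<comment> \<open>Only the outer brackets are unfolded first, so that \<open>op\<close> can
    rewrite the weight operator on the inner ones. The terms containing \<open>?U\<close> and the
    terms with two factors \<open>weight_op\<close> then cancel separately in the cyclic
    sum.\<close>
  show ?thesis
    unfolding weight_bracket_eq[where f = x and g = "weight_bracket V w y z"]
      weight_bracket_eq[where f = y and g = "weight_bracket V w z x"]
      weight_bracket_eq[where f = z and g = "weight_bracket V w x y"] op
    unfolding weight_bracket_eq by (simp add: algebra_simps)
qed

lemma weight_lie_bialgebra:
  fixes V :: "'v set" and w :: "'v \<Rightarrow> 'v \<Rightarrow> 'a::comm_ring_1"
  assumes "finite V" and sym: "\<And>i j. i \<in> V \<Longrightarrow> j \<in> V \<Longrightarrow> w i j = w j i"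
    and orth: "\<forall>i\<in>V. \<forall>j\<in>V. \<forall>k\<in>V. j \<noteq> k \<longrightarrow> w i j * w i k = 0"
  shows "lie_bialgebra_on V (weight_bracket V w) (weight_cobracket V w)"
proof -
  let ?B = "weight_bracket V w" and ?D = "weight_cobracket V w"
  note jacobi = weight_bracket_jacobi[OF assms(1) _ assms(2,3)]
  have "?B x (?B y z) + ?B y (?B z x) + ?B z (?B x y) = 0"
    if "x \<in> free_mod V" "y \<in> free_mod V" "z \<in> free_mod V" for x y z
  proof
    fix i
    show "(?B x (?B y z) + ?B y (?B z x) + ?B z (?B x y)) i = 0 i"
    proof (cases "i \<in> V")
      case True
      then show ?thesis using jacobi by simp
    next
      case False
      have "?B x (?B y z) \<in> free_mod V" "?B y (?B z x) \<in> free_mod V" "?B z (?B x y) \<in> free_mod V"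
        using that by (simp_all add: weight_bracket_in_free_mod)
      then show ?thesis using False by (simp add: free_mod_def)
    qed
  qed
  then have lie: "lie_algebra_on V ?B"
    unfolding lie_algebra_on_def
    by (auto simp: weight_bracket_in_free_mod weight_bracket_bilinear)
      (simp add: fun_eq_iff weight_bracket_eq)
  have "co_jacobi V ?D"
    unfolding co_jacobi_def
  proof (intro ballI)
    fix \<xi> \<eta> \<zeta> :: "('v \<Rightarrow> 'a) \<Rightarrow> 'a" and x :: "'v \<Rightarrow> 'a"
    let ?h = "\<lambda>\<xi> i. \<xi> (basis_vec i) :: 'a"
    have dual: "dual_bracket V ?D \<xi> \<eta> x = (\<Sum>i\<in>V. x i * ?B (?h \<xi>) (?h \<eta>) i)" for \<xi> \<eta> x
      by (rule dual_bracket_weight_cobracket[OF assms(1,2)])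
    \<comment> \<open>Evaluation at \<open>basis_vec i\<close> recovers the coordinates of a dual
      bracket, so nested dual brackets become nested weight brackets.\<close>
    have hat: "dual_bracket V ?D \<eta> \<zeta> (basis_vec i) = ?B (?h \<eta>) (?h \<zeta>) i" if "i \<in> V" for i \<eta> \<zeta>
    proof -
      have "dual_bracket V ?D \<eta> \<zeta> (basis_vec i) =
          (\<Sum>k\<in>V. if k = i then ?B (?h \<eta>) (?h \<zeta>) k else 0)"
        unfolding dual by (intro sum.cong) (auto simp: basis_vec_def)
      then show ?thesis using that assms(1) by simp
    qed
    have nest: "dual_bracket V ?D \<xi> (dual_bracket V ?D \<eta> \<zeta>) x =
        (\<Sum>i\<in>V. x i * ?B (?h \<xi>) (?B (?h \<eta>) (?h \<zeta>)) i)" for \<xi> \<eta> \<zeta>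
      unfolding dual[of \<xi>]
      by (intro sum.cong refl arg_cong2[where f = "(*)"])
        (simp add: weight_bracket_def hat)
    show "dual_bracket V ?D \<xi> (dual_bracket V ?D \<eta> \<zeta>) x +
        dual_bracket V ?D \<eta> (dual_bracket V ?D \<zeta> \<xi>) x +
        dual_bracket V ?D \<zeta> (dual_bracket V ?D \<xi> \<eta>) x = 0"
      unfolding nest sum.distrib[symmetric] distrib_left[symmetric]
      by (intro sum.neutral) (simp add: jacobi)
  qed
  moreover have "cocycle V ?B ?D"
    unfolding cocycle_def
  proof (intro ballI ext)
    fix x y :: "'v \<Rightarrow> 'a" and a b
    assume xy: "x \<in> free_mod V" "y \<in> free_mod V"
    show "?D (?B x y) a b = (ad2 V ?B x (?D y) - ad2 V ?B y (?D x)) a b"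
    proof (cases "a \<in> V \<and> b \<in> V \<and> a \<noteq> b")
      case False
      then have "?D (?B x y) a b = 0"
        by (auto simp: weight_cobracket_apply[OF assms(1,2)])
      then show ?thesis
        using False xy by (auto simp: ad2_weight_cobracket_eq_0[OF assms(1,2)])
    next
      case True
      then have sum0: "(\<Sum>k\<in>V. w k a * w k b * c k) = 0" for c
        using orth by (intro sum.neutral) auto
      have op: "w a b * weight_op V w f a = w a b * w a b * f b"
        "w a b * weight_op V w f b = w a b * w a b * f a" for f
        using True sym[of a b] weight_op_orthogonal[OF assms(1) _ _ assms(2,3), of b a f]
          weight_op_orthogonal[OF assms(1) _ _ assms(2,3), of a b f] by simp_all
      have ad: "ad2 V ?B x (?D y) a b = - (w a b * w a b * (x a + x b) * (y a - y b))" for x y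
      proof -
        have "ad2 V ?B x (?D y) a b =
            - ((w a b * weight_op V w x a + w a b * weight_op V w x b) * (y a - y b))"
          using True by (simp add: ad2_weight_cobracket[OF assms(1,2)] sum0)
            (simp add: algebra_simps)
        then show ?thesis unfolding op by (simp add: algebra_simps)
      qed
      have "?D (?B x y) a b =
          x a * (w a b * weight_op V w y a) - y a * (w a b * weight_op V w x a)
          - x b * (w a b * weight_op V w y b) + y b * (w a b * weight_op V w x b)"
        using True by (simp add: weight_cobracket_apply[OF assms(1,2)] weight_bracket_eq algebra_simps)
      \<comment> \<open>Both sides equal
        \<open>2 * w a b * w a b * (x a * y b - x b * y a)\<close>.\<close>
      then show ?thesis
        by (simp add: ad op algebra_simps)
    qed
  qed
  ultimately show ?thesis
    using lie weight_cobracket_in_ext2[OF assms(1,2)] weight_cobracket_linear[OF assms(1,2)]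
    by (auto simp: lie_bialgebra_on_def)
qed

section \<open>Necessity: the constraints from basis vectors at three distinct points\<close>

lemma weight_jacobi_necessary:
  assumes "finite V" and sym: "\<And>i j. i \<in> V \<Longrightarrow> j \<in> V \<Longrightarrow> w i j = w j i"
    and V: "a \<in> V" "b \<in> V" "c \<in> V" "a \<noteq> b" "a \<noteq> c" "b \<noteq> c"
    and "lie_algebra_on V (weight_bracket V w)"
  shows "w b c * w a b = w b c * w a c"
proof -
  let ?B = "weight_bracket V w" and ?e = basis_vec
  have basis: "?B (?e p) (?e q) = scale1 (w p q) (?e p) + scale1 (- w p q) (?e q)"
    if "p \<in> V" "q \<in> V" for p q
    using that sym[of p q] assms(1)
    by (simp add: fun_eq_iff weight_bracket_basis_vec weight_op_basis_vec scale1_def)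
      (simp add: basis_vec_def)
  have op: "weight_op V w (?B (?e p) (?e q)) i = w p q * (w i p - w i q)"
    if "p \<in> V" "q \<in> V" for p q i
    using that assms(1)
    by (simp add: basis weight_op_add weight_op_scale1 weight_op_basis_vec algebra_simps)
  have "\<forall>x\<in>free_mod V. \<forall>y\<in>free_mod V. \<forall>z\<in>free_mod V.
      ?B x (?B y z) + ?B y (?B z x) + ?B z (?B x y) = 0"
    using assms(9) unfolding lie_algebra_on_def by blast
  then have "(?B (?e a) (?B (?e b) (?e c)) + ?B (?e b) (?B (?e c) (?e a))
      + ?B (?e c) (?B (?e a) (?e b))) a = 0"
    using V by (simp add: basis_vec_in)
  \<comment> \<open>The three cyclic summands contribute in this order; the last two cancel by
    symmetry.\<close>
  then have "w b c * (w a b - w a c) + w c a * w a b - w a b * w a c = 0"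
    using V assms(1)
    by (simp add: weight_bracket_eq[of _ _ _ "weight_bracket _ _ _ _"] op weight_op_basis_vec)
      (simp add: basis scale1_def, simp add: basis_vec_def)
  then show ?thesis
    using sym[of c a] V by (simp add: algebra_simps)
qed

lemma weight_cocycle_necessary:
  assumes "finite V" and sym: "\<And>i j. i \<in> V \<Longrightarrow> j \<in> V \<Longrightarrow> w i j = w j i"
    and "\<And>i. i \<in> V \<Longrightarrow> w i i = 0"
    and V: "a \<in> V" "b \<in> V" "c \<in> V" "a \<noteq> b" "a \<noteq> c" "b \<noteq> c"
    and "cocycle V (weight_bracket V w) (weight_cobracket V w)"
  shows "w b c * w a b + w b c * w a c = 0"
proof -
  let ?B = "weight_bracket V w" and ?D = "weight_cobracket V w" and ?e = basis_vec
  \<comment> \<open>Of all paths from \<open>a\<close> to \<open>c\<close>, the vector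
    \<open>?e b\<close> selects the one through \<open>b\<close>.\<close>
  have delta: "(\<Sum>k\<in>V. w k a * w k c * ?e b k) = w b a * w b c"
    using assms(1) V by (simp add: basis_vec_def if_distrib cong: if_cong)
  have "?D (?B (?e a) (?e b)) a c = ad2 V ?B (?e a) (?D (?e b)) a c - ad2 V ?B (?e b) (?D (?e a)) a c"
    using assms(10) V by (simp add: cocycle_def basis_vec_in)
  moreover have "?D (?B (?e a) (?e b)) a c = w a c * w a b"
    using V by (simp add: weight_cobracket_apply[OF assms(1,2)] weight_bracket_basis_vec[OF assms(1)])
      (simp add: basis_vec_def)
  moreover have "ad2 V ?B (?e a) (?D (?e b)) a c = w a b * w b c"
  proof -
    have "?e a a = (1::'b)" "?e a c = (0::'b)" "?e b a = (0::'b)" "?e b c = (0::'b)"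
      using V by (simp_all add: basis_vec_def)
    then show ?thesis
      using V delta sym[of a b] by (simp add: ad2_weight_cobracket[OF assms(1,2)])
  qed
  moreover have "ad2 V ?B (?e b) (?D (?e a)) a c = - (w a b + w c b) * w a c"
  proof -
    have "?e a a = (1::'b)" "?e a c = (0::'b)" "?e b a = (0::'b)" "?e b c = (0::'b)"
      using V by (simp_all add: basis_vec_def)
    then show ?thesis
      using V by (simp add: ad2_weight_cobracket[OF assms(1,2)] weight_op_basis_vec[OF assms(1)]
          algebra_simps)
  qed
  \<comment> \<open>The product \<open>w a b * w a c\<close> occurs on both sides of the cocycle
    identity and cancels.\<close>
  ultimately show ?thesis
    using sym[of c b] V by (simp add: algebra_simps)
qed

theorem theorem3p2:
  fixes V :: "'v set" and w :: "'v \<Rightarrow> 'v \<Rightarrow> 'a::comm_ring_1"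
  assumes "\<And>x::'a. 2 * x = 0 \<Longrightarrow> x = 0"
    and "finite V"
    and "\<And>i j. i \<in> V \<Longrightarrow> j \<in> V \<Longrightarrow> w i j = w j i"
    and "\<And>i. i \<in> V \<Longrightarrow> w i i = 0"
  shows "lie_bialgebra_on V (weight_bracket V w) (weight_cobracket V w) \<longleftrightarrow>
    (\<forall>i\<in>V. \<forall>j\<in>V. \<forall>k\<in>V. j \<noteq> k \<longrightarrow> w i j * w i k = 0)"
proof
  assume "lie_bialgebra_on V (weight_bracket V w) (weight_cobracket V w)"
  then have lie: "lie_algebra_on V (weight_bracket V w)"
    and coc: "cocycle V (weight_bracket V w) (weight_cobracket V w)"
    by (auto simp: lie_bialgebra_on_def)
  show "\<forall>i\<in>V. \<forall>j\<in>V. \<forall>k\<in>V. j \<noteq> k \<longrightarrow> w i j * w i k = 0"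
  proof (intro ballI impI)
    fix i j k assume V: "i \<in> V" "j \<in> V" "k \<in> V" "j \<noteq> k"
    show "w i j * w i k = 0"
    proof (cases "i = j \<or> i = k")
      case True
      then show ?thesis using assms(4) V by auto
    next
      case False
      \<comment> \<open>The shared index \<open>i\<close> takes the role of \<open>b\<close>, with
        \<open>j\<close> and \<open>k\<close> as \<open>a\<close> and \<open>c\<close>, so that the
        term common to both relations is the wanted product.\<close>
      then have "w i k * w j i = w i k * w j k" "w i k * w j i + w i k * w j k = 0"
        using weight_jacobi_necessary[OF assms(2,3) V(2,1,3) _ V(4) _ lie]
          weight_cocycle_necessary[OF assms(2,3,4) V(2,1,3) _ V(4) _ coc] by auto
      then have "2 * (w i k * w j i) = 0" by simp
      then show ?thesis
        using assms(1) assms(3)[OF V(1,2)] by (metis mult.commute)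
    qed
  qed
next
  assume "\<forall>i\<in>V. \<forall>j\<in>V. \<forall>k\<in>V. j \<noteq> k \<longrightarrow> w i j * w i k = 0"
  then show "lie_bialgebra_on V (weight_bracket V w) (weight_cobracket V w)"
    by (intro weight_lie_bialgebra assms(2,3))
qed

end
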